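(* Let $\mathcal{M}=(Q,\Sigma,\cdot,\circ)$ be an automaton in the class $\mathcal{S}_a$, with sink-state $e$. The following are equivalent: (i) $\mathcal{E}(\mathcal{M})=\varnothing$, and for any $\xi\in\Sigma^\omega$ and $g\in\mathrm{Stab}^{+}(\xi)$ there is $n\ge1$ with $g\cdot\xi[:n]=1$; (ii) $\mathcal{E}(\mathcal{M})=\varnothing$, and for any nonempty $v\in\Sigma^*$ and $g\in\mathrm{Stab}^{+}(v^\omega)$ there is $n\ge1$ with $g\cdot v^n=1$; (iii) for any $k,n\ge1$, the helix graph $\mathcal{H}_{k,n}$ is singular; (iv) there is no non-elementary pair of commuting words, i.e. there are no nonempty words $u\in(Q\setminus\{e\})^*$, $v\in\Sigma^*$ with $u\cdot v=u$ and $u\circ v=v$.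
   Context: A Mealy automaton is $\mathcal{M}=(Q,\Sigma,\cdot,\circ)$ with finite nonempty sets $Q$ (states) and $\Sigma$ (alphabet), a transition function $(q,a)\mapsto q\cdot a\in Q$ and a production function $(q,a)\mapsto q\circ a\in\Sigma$. Extend to words: $q\circ(a_1\cdots a_n)=(q\circ a_1)\big((q\cdot a_1)\circ(a_2\cdots a_n)\big)$, $q\cdot(a_1\cdots a_n)=(\cdots(q\cdot a_1)\cdots)\cdot a_n$, and for $h,g\in Q^*$, $v\in\Sigma^*$: $(hg)\circ v=h\circ(g\circ v)$, $(hg)\cdot v=\big(h\cdot(g\circ v)\big)(g\cdot v)$. So $u\circ v\in\Sigma^{|v|}$, $u\cdot v\in Q^{|u|}$. It is invertible if each map $a\mapsto q\circ a$ is a permutation of $\Sigma$; then the states generate a group $\langle\mathcal{M}\rangle$ (identity $1$) of automorphisms of the tree $\Sigma^*$, acting on $\Sigma^\omega$. $\pi(u)\in\langle\mathcal{M}\rangle$ is the element represented by $u\in Q^*$. For $g\in\langle\mathcal{M}\rangle$, $v\in\Sigma^*$, $g\cdot v\in\langle\mathcal{M}\rangle$ is the unique element with $g\circ(vw)=(g\circ v)\big((g\cdot v)\circ w\big)$ for all $w$. $\xi[:n]$ is the prefix of length $n$ of $\xi$; $v^\omega=vvv\cdots$. $\mathrm{Stab}^+(\xi)=\{\pi(u):u\in Q^*,\ \pi(u)\circ\xi=\xi\}$. $\mathcal{S}_a$ is the class of invertible Mealy automata having a sink-state $e$ (i.e. $e\cdot a=e$ and $e\circ a=a$ for all $a\in\Sigma$;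 it is unique) that is accessible from every state. The set of non-elementary relations is $\mathcal{E}(\mathcal{M})=\{u\in(Q\setminus\{e\})^*:\pi(u)=1\text{ and there is a nonempty } v\in\Sigma^*\text{ with }|u\cdot v^n|_e<|u|\text{ for all }n\ge1\}$, where $|w|_e$ is the number of occurrences of $e$ in $w$. The helix graph $\mathcal{H}_{k,n}$ is the directed graph with vertex set $Q^k\times\Sigma^n$ and arcs $(u,v)\to(u\cdot v,u\circ v)$. It is singular if each of its connected components has a unique cycle, which is of the form $(e^k,v)\to(e^k,v)$ for some $v\in\Sigma^n$. *)

theory Defs
  imports
    "HOL-Library.Stream"
    "HOL-Algebra.Bij"
    "HOL-Algebra.Generated_Groups"
    "Graph_Theory.Graph_Theory"
begin

text \<open>
  The state set and the alphabet are the (finite, automatically nonempty) universes of the types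
  \<open>'q\<close> and \<open>'a\<close>.  The fields are \<open>q \<cdot> a\<close> (\<open>delta\<close>) and \<open>q \<circ> a\<close> (\<open>rho\<close>).
\<close>

record ('q, 'a) mealy =
  delta :: "'q \<Rightarrow> 'a \<Rightarrow> 'q"
  rho :: "'q \<Rightarrow> 'a \<Rightarrow> 'a"

primrec state_act :: "('q, 'a) mealy \<Rightarrow> 'q \<Rightarrow> 'a list \<Rightarrow> 'a list" where
  "state_act M q [] = []"
| "state_act M q (a # w) = rho M q a # state_act M (delta M q a) w"

primrec state_trans :: "('q, 'a) mealy \<Rightarrow> 'q \<Rightarrow> 'a list \<Rightarrow> 'q" where
  "state_trans M q [] = q"
| "state_trans M q (a # w) = state_trans M (delta M q a) w"

text \<open>
  \<open>word_act M u v\<close> is \<open>u \<circ> v\<close> and \<open>word_trans M u v\<close> is \<open>u \<cdot> v\<close>; the rightmost letter of \<open>u\<close> reads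
  \<open>v\<close> first.  As a map on the tree of words over \<open>'a\<close>, the element \<open>\<pi>(u)\<close> is \<open>word_act M u\<close>.
\<close>

primrec word_act :: "('q, 'a) mealy \<Rightarrow> 'q list \<Rightarrow> 'a list \<Rightarrow> 'a list" where
  "word_act M [] v = v"
| "word_act M (q # u) v = state_act M q (word_act M u v)"

primrec word_trans :: "('q, 'a) mealy \<Rightarrow> 'q list \<Rightarrow> 'a list \<Rightarrow> 'q list" where
  "word_trans M [] v = []"
| "word_trans M (q # u) v = state_trans M q (word_act M u v) # word_trans M u v"

definition invertible_mealy :: "('q, 'a) mealy \<Rightarrow> bool" where
  "invertible_mealy M \<longleftrightarrow> (\<forall>q. bij (rho M q))"

definition sink_state :: "('q, 'a) mealy \<Rightarrow> 'q \<Rightarrow> bool" where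
  "sink_state M e \<longleftrightarrow> (\<forall>a. delta M e a = e \<and> rho M e a = a)"

definition class_Sa :: "('q::finite, 'a::finite) mealy set" where
  "class_Sa = {M. invertible_mealy M \<and>
     (\<exists>e. sink_state M e \<and> (\<forall>q. \<exists>w. state_trans M q w = e))}"

abbreviation word_perms :: "('a list \<Rightarrow> 'a list) monoid" where
  "word_perms \<equiv> BijGroup UNIV"

definition mealy_group :: "('q, 'a) mealy \<Rightarrow> ('a list \<Rightarrow> 'a list) set" where
  "mealy_group M = generate word_perms (range (state_act M))"

definition group_section ::
    "('q, 'a) mealy \<Rightarrow> ('a list \<Rightarrow> 'a list) \<Rightarrow> 'a list \<Rightarrow> ('a list \<Rightarrow> 'a list)" where
  "group_section M g v = (THE h. h \<in> mealy_group M \<and> (\<forall>w. g (v @ w) = g v @ h w))"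

text \<open>
  The action on infinite words: letter \<open>i\<close> of \<open>g \<circ> \<xi>\<close> is the last letter of \<open>g\<close> applied to the
  prefix of \<open>\<xi>\<close> of length \<open>i + 1\<close>.  For a tree automorphism \<open>g\<close> this is the infinite word whose
  prefixes are the images under \<open>g\<close> of the prefixes of \<open>\<xi>\<close>.
\<close>

definition omega_act :: "('a list \<Rightarrow> 'a list) \<Rightarrow> 'a stream \<Rightarrow> 'a stream" where
  "omega_act g \<xi> = smap (\<lambda>i. g (stake (Suc i) \<xi>) ! i) nats"

definition Stab_plus :: "('q, 'a) mealy \<Rightarrow> 'a stream \<Rightarrow> ('a list \<Rightarrow> 'a list) set" where
  "Stab_plus M \<xi> = {word_act M u | u. omega_act (word_act M u) \<xi> = \<xi>}"

abbreviation word_pow :: "'a list \<Rightarrow> nat \<Rightarrow> 'a list" where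
  "word_pow v n \<equiv> concat (replicate n v)"

definition nonelementary_relations :: "('q, 'a) mealy \<Rightarrow> 'q \<Rightarrow> 'q list set" where
  "nonelementary_relations M e =
     {u. e \<notin> set u \<and> word_act M u = \<one>\<^bsub>word_perms\<^esub> \<and>
         (\<exists>v. v \<noteq> [] \<and> (\<forall>n\<ge>1. count_list (word_trans M u (word_pow v n)) e < length u))}"

definition helix_graph ::
    "('q, 'a) mealy \<Rightarrow> nat \<Rightarrow> nat \<Rightarrow> ('q list \<times> 'a list) pair_pre_digraph" where
  "helix_graph M k n =
     \<lparr> pverts = {(u, v). length u = k \<and> length v = n},
       parcs = {((u, v), (word_trans M u v, word_act M u v)) | u v. length u = k \<and> length v = n} \<rparr>"

text \<open>
  Connected components in the undirected sense: the maximal connected induced subgraphs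
  (compare the library's \<open>sccs\<close>, which uses strong connectivity).
\<close>

definition components :: "('v, 'b) pre_digraph \<Rightarrow> ('v, 'b) pre_digraph set" where
  "components G = {H. induced_subgraph H G \<and> Digraph_Component.connected H \<and>
     \<not> (\<exists>H'. induced_subgraph H' G \<and> Digraph_Component.connected H' \<and> verts H \<subset> verts H')}"

text \<open>
  A cycle in the library is a list of arcs with a chosen starting point.  As a one-arc cycle has
  only one starting point, the unique cycle being a given loop means that the loop is the only
  such list.
\<close>

definition singular_helix :: "('q, 'a) mealy \<Rightarrow> 'q \<Rightarrow> nat \<Rightarrow> nat \<Rightarrow> bool" where
  "singular_helix M e k n \<longleftrightarrow>
     (\<forall>C \<in> components (with_proj (helix_graph M k n)). \<exists>v. length v = n \<and>
        {p. pre_digraph.cycle C p} = {[((replicate k e, v), (replicate k e, v))]})"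

definition nonelementary_commuting_pair :: "('q, 'a) mealy \<Rightarrow> 'q \<Rightarrow> 'q list \<Rightarrow> 'a list \<Rightarrow> bool" where
  "nonelementary_commuting_pair M e u v \<longleftrightarrow>
     u \<noteq> [] \<and> v \<noteq> [] \<and> e \<notin> set u \<and> word_trans M u v = u \<and> word_act M u v = v"

end

theory Submission
  imports Defs
begin

text \<open>
  Everything reduces to the absence of non-elementary commuting pairs, statement (iv).  The letters
  \<open>e\<close> of a word act trivially and are never transformed, so a commuting relation \<open>u \<cdot> v = u\<close>,
  \<open>u \<circ> v = v\<close> survives the deletion of every \<open>e\<close> from \<open>u\<close>; under (iv) it therefore
  forces \<open>u\<close> to be a power of \<open>e\<close> (\<open>commuting_word_is_sinks\<close>).

  Suppose (iv), and let \<open>u\<close> fix a ray \<open>\<xi>\<close>.  The words \<open>u \<cdot> \<xi>[:n]\<close> all have length \<open>|u|\<close>,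
  so two of them agree; the factor of \<open>\<xi>\<close> read between the two commutes with their common value,
  which is then \<open>e\<^sup>k\<close> with \<open>k = |u|\<close> (\<open>fixed_ray_reaches_sink\<close>).  This is the condition
  on stabilisers in (i).
  Applied to a relation \<open>u\<close>, which fixes the ray \<open>v\<^sup>\<omega>\<close>, it also shows that \<open>u \<cdot> v\<^sup>n\<close> is
  \<open>e\<^sup>k\<close> for some \<open>n\<close>, so there are no non-elementary relations and (i) holds.  Clearly
  (i) implies (ii), since the prefix of length \<open>n\<close> of \<open>v\<^sup>\<omega>\<close> is a prefix of \<open>v\<^sup>n\<close>.
  Finally, given (ii), a commuting pair \<open>(u, v)\<close> satisfies \<open>u \<cdot> v\<^sup>n = u\<close> for all \<open>n\<close>
  and stabilises \<open>v\<^sup>\<omega>\<close>, so \<open>\<pi>(u) = 1\<close>, which makes \<open>u\<close> a non-elementary relation.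

  For (iii), the helix graph is the graph of a self-map of a finite set, so each component has
  exactly one cycle as soon as all periodic points are fixed points
  (\<open>component_unique_loop\<close>).  A commuting pair is a fixed point, and its loop is not of the
  required form.  Conversely a periodic point \<open>(u, v)\<close> of the helix map with orbit
  \<open>(u\<^sub>i, v\<^sub>i)\<close> of period \<open>m\<close> unfolds to an \<open>m \<times> m\<close> grid of cross diagrams whose cell
  \<open>(i, j)\<close> has input \<open>(u\<^sub>i\<^sub>+\<^sub>j, v\<^sub>i\<^sub>+\<^sub>j)\<close>; its opposite sides agree, so the
  product of the \<open>u\<^sub>i\<close> commutes with the product of the \<open>v\<^sub>i\<close>, and under (iv) every
  \<open>u\<^sub>i\<close> is a power of \<open>e\<close> (\<open>periodic_helix_vertex\<close>).
\<close>

section \<open>Components and cycles of functional graphs\<close>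

definition functional_graph :: "'v set \<Rightarrow> ('v \<Rightarrow> 'v) \<Rightarrow> 'v pair_pre_digraph" where
  "functional_graph V f = \<lparr> pverts = V, parcs = {(x, f x) | x. x \<in> V} \<rparr>"

text \<open>
  Adjacency in the underlying undirected graph.  It is not restricted to the vertices, because
  \<open>rtrancl_on\<close> already confines paths to a given set; this way the same relation serves all
  induced subgraphs.
\<close>

definition link :: "('v \<Rightarrow> 'v) \<Rightarrow> ('v \<times> 'v) set" where
  "link f = {(x, y). y = f x \<or> x = f y}"

lemma rtrancl_on_cong_on:
  assumes "\<And>x y. x \<in> S \<Longrightarrow> y \<in> S \<Longrightarrow> (x, y) \<in> r \<longleftrightarrow> (x, y) \<in> r'"
  shows "rtrancl_on S r = rtrancl_on S r'"
proof -
  have transfer: "(a, b) \<in> rtrancl_on S t"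
    if "(a, b) \<in> rtrancl_on S s" "\<And>x y. x \<in> S \<Longrightarrow> y \<in> S \<Longrightarrow> (x, y) \<in> s \<Longrightarrow> (x, y) \<in> t" for a b s t
    using that(1)
  proof (induction rule: rtrancl_on_induct)
    case (step y z)
    then show ?case
      using that(2) by (blast intro: rtrancl_on_into_rtrancl_on)
  qed simp
  show ?thesis
    using transfer[of _ _ r r'] transfer[of _ _ r' r] assms by (intro equalityI subrelI) blast+
qed

lemma induced_functional_graph_projections:
  assumes "induced_subgraph H (with_proj (functional_graph V f))"
  shows "tail H = fst" "head H = snd" "verts H \<subseteq> V"
    "arcs H = {(x, f x) | x. x \<in> verts H \<and> f x \<in> verts H}"
proof -
  have sub: "subgraph H (with_proj (functional_graph V f))"
    using assms by (auto simp: induced_subgraph_def)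
  then show *: "tail H = fst" "head H = snd" "verts H \<subseteq> V"
    by (auto simp: subgraph_def compatible_def with_proj_def functional_graph_def)
  show "arcs H = {(x, f x) | x. x \<in> verts H \<and> f x \<in> verts H}"
    using assms * by (auto simp: induced_subgraph_def with_proj_def functional_graph_def)
qed

lemma connected_induced_functional_graph_iff:
  assumes "induced_subgraph H (with_proj (functional_graph V f))"
  shows "Digraph_Component.connected H \<longleftrightarrow>
    verts H \<noteq> {} \<and> (\<forall>x\<in>verts H. \<forall>y\<in>verts H. (x, y) \<in> rtrancl_on (verts H) (link f))"
proof -
  have "rtrancl_on (verts H) (arcs_ends (with_proj (mk_symmetric H)))
      = rtrancl_on (verts H) (link f)"
    by (rule rtrancl_on_cong_on)
      (auto simp: arcs_ends_def arc_to_ends_def with_proj_def parcs_mk_symmetric link_def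
        induced_functional_graph_projections[OF assms])
  then show ?thesis
    by (simp add: Digraph_Component.connected_def strongly_connected_def reachable_def)
qed

lemma induced_functional_graph:
  assumes "f ` V \<subseteq> V" "S \<subseteq> V"
  shows "induced_subgraph (with_proj (functional_graph V f) \<restriction> S) (with_proj (functional_graph V f))"
proof -
  have "wf_digraph (with_proj (functional_graph V f))"
    using assms(1) by unfold_locales (auto simp: with_proj_def functional_graph_def)
  then show ?thesis
    using assms(2)
    by (intro wf_digraph.induced_induce) (auto simp: with_proj_def functional_graph_def)
qed

text \<open>
  Among the finitely many vertex sets of connected induced subgraphs containing \<open>x\<close> (one of them
  is \<open>{x}\<close>) a maximal one belongs to a component.
\<close>

lemma vertex_in_component:
  assumes "finite V" "f ` V \<subseteq> V" "x \<in> V"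
  obtains C where "C \<in> components (with_proj (functional_graph V f))" "x \<in> verts C"
proof -
  let ?G = "with_proj (functional_graph V f)"
  define A where "A = verts ` {H. induced_subgraph H ?G \<and> Digraph_Component.connected H}"
  have "A \<subseteq> Pow V"
    unfolding A_def using induced_functional_graph_projections(3) by blast
  then have "finite A"
    by (rule finite_subset) (simp add: assms(1))
  moreover have ind: "induced_subgraph (?G \<restriction> {x}) ?G"
    using assms by (intro induced_functional_graph) auto
  then have "Digraph_Component.connected (?G \<restriction> {x})"
    by (simp add: connected_induced_functional_graph_iff)
  then have "{x} \<in> A"
    unfolding A_def using ind by (intro rev_image_eqI[of "?G \<restriction> {x}"]) simp_all
  ultimately obtain S where S: "S \<in> A" "{x} \<subseteq> S" "\<forall>T\<in>A. S \<subseteq> T \<longrightarrow> S = T"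
    by (rule finite_has_maximal2[THEN bexE]) (elim conjE)
  then obtain C where C: "S = verts C" "induced_subgraph C ?G" "Digraph_Component.connected C"
    unfolding A_def by blast
  have "\<not> verts C \<subset> verts H" if "induced_subgraph H ?G" "Digraph_Component.connected H" for H
  proof -
    have "verts H \<in> A"
      unfolding A_def using that by (intro imageI) simp
    then show ?thesis
      using S(3) C(1) by blast
  qed
  then have "C \<in> components ?G"
    unfolding components_def using C(2,3) by blast
  then show thesis
    using that C(1) S(2) by blast
qed

text \<open>
  If \<open>f x\<close> lay outside the component, it could be added without destroying connectedness, because
  it is adjacent to \<open>x\<close>; this contradicts maximality.
\<close>

lemma component_closed:
  assumes "f ` V \<subseteq> V" "C \<in> components (with_proj (functional_graph V f))" "x \<in> verts C"
  shows "f x \<in> verts C"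
proof (rule ccontr)
  let ?G = "with_proj (functional_graph V f)"
  let ?S = "insert (f x) (verts C)"
  assume new: "f x \<notin> verts C"
  have C: "induced_subgraph C ?G" "Digraph_Component.connected C"
    and max: "\<And>H. induced_subgraph H ?G \<Longrightarrow> Digraph_Component.connected H \<Longrightarrow> \<not> verts C \<subset> verts H"
    using assms(2) by (auto simp: components_def)
  have ind: "induced_subgraph (?G \<restriction> ?S) ?G"
    using assms(1,3) induced_functional_graph_projections(3)[OF C(1)]
    by (intro induced_functional_graph) auto
  have inC: "(a, b) \<in> rtrancl_on ?S (link f)" if "a \<in> verts C" "b \<in> verts C" for a b
    using C that rtrancl_on_mono[of "link f" "link f" "verts C" ?S a b]
    by (auto simp: connected_induced_functional_graph_iff)
  have step: "(x, f x) \<in> rtrancl_on ?S (link f)" "(f x, x) \<in> rtrancl_on ?S (link f)"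
    using assms(3) by (auto intro!: rtrancl_on_into_rtrancl_on[OF rtrancl_on_refl] simp: link_def)
  have "(a, x) \<in> rtrancl_on ?S (link f) \<and> (x, a) \<in> rtrancl_on ?S (link f)" if "a \<in> ?S" for a
    using that inC step assms(3) by auto
  then have "Digraph_Component.connected (?G \<restriction> ?S)"
    unfolding connected_induced_functional_graph_iff[OF ind]
    by (auto intro: rtrancl_on_trans)
  then show False
    using max[OF ind] new by auto
qed

lemma funpow_add_apply: "(f ^^ (m + n)) x = (f ^^ m) ((f ^^ n) x)"
  by (simp add: funpow_add)

text \<open>
  Undirected paths may run against the arrows, but merging of forward orbits is preserved by a step
  in either direction; this is why a component of a functional graph has at most one cycle.
\<close>

lemma linked_orbits_meet:
  assumes "(x, y) \<in> rtrancl_on S (link f)"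
  shows "\<exists>i j. (f ^^ i) x = (f ^^ j) y"
  using assms
proof (induction rule: rtrancl_on_induct)
  case base
  then show ?case by blast
next
  case (step y z)
  then obtain i j where ij: "(f ^^ i) x = (f ^^ j) y" by blast
  show ?case
  proof (cases "z = f y")
    case True
    have "(f ^^ Suc i) x = (f ^^ j) z"
      using ij True by (simp add: funpow_swap1)
    then show ?thesis by blast
  next
    case False
    then have "y = f z" using step by (auto simp: link_def)
    then have "(f ^^ i) x = (f ^^ Suc j) z"
      using ij by (simp add: funpow_swap1)
    then show ?thesis by blast
  qed
qed

lemma walk_follows_orbit:
  assumes "induced_subgraph H (with_proj (functional_graph V f))" "pre_digraph.awalk H x p y"
  shows "y = (f ^^ length p) x"
  using assms(2)
proof (induction p arbitrary: x)
  case Nil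
  then show ?case
    by (simp add: pre_digraph.awalk_def pre_digraph.cas.simps)
next
  case (Cons a p)
  then have "a = (x, f x)" "f x \<in> verts H" "pre_digraph.awalk H (f x) p y"
    using induced_functional_graph_projections[OF assms(1)]
    by (auto simp: pre_digraph.awalk_def pre_digraph.cas.simps)
  then show ?case
    using Cons.IH by (simp add: funpow_swap1)
qed

lemma cycle_at_fixed_point:
  assumes "induced_subgraph H (with_proj (functional_graph V f))" "f x = x" "x \<in> verts H"
  shows "pre_digraph.cycle H [(x, x)]"
proof -
  have "(x, x) \<in> arcs H"
    using assms(2,3) by (auto simp: induced_functional_graph_projections[OF assms(1)])
  then show ?thesis
    using assms(3) induced_functional_graph_projections(1,2)[OF assms(1)]
    unfolding pre_digraph.cycle_def pre_digraph.awalk_def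
    by (intro exI[of _ x]) (simp add: pre_digraph.cas.simps pre_digraph.awalk_verts.simps)
qed

lemma cycle_through_fixed_point:
  assumes "induced_subgraph H (with_proj (functional_graph V f))"
    and "pre_digraph.awalk H x p x" "distinct (tl (pre_digraph.awalk_verts H x p))" "p \<noteq> []" "f x = x"
  shows "p = [(x, x)]"
proof -
  have loops: "set p \<subseteq> {(x, x)}" and visits: "set (pre_digraph.awalk_verts H x p) \<subseteq> {x}"
    using assms(2)
  proof (induction p)
    case (Cons a p)
    {
      case 1
      then show ?case using Cons assms(5) induced_functional_graph_projections[OF assms(1)]
        by (auto simp: pre_digraph.awalk_def pre_digraph.cas.simps)
    next
      case 2
      then show ?case using Cons assms(5) induced_functional_graph_projections[OF assms(1)]
        by (auto simp: pre_digraph.awalk_def pre_digraph.cas.simps pre_digraph.awalk_verts.simps)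
    }
  qed (auto simp: pre_digraph.awalk_verts.simps)
  \<comment> \<open>Two arcs would make the walk visit \<open>x\<close> twice after its start.\<close>
  obtain a q where p: "p = a # q" using assms(4) by (cases p) auto
  have "q = []"
  proof (cases q)
    case (Cons b r)
    then have "pre_digraph.awalk_verts H x p
        = [tail H a, tail H b] @ pre_digraph.awalk_verts H (head H b) r"
      by (simp add: p pre_digraph.awalk_verts.simps)
    moreover have "pre_digraph.awalk_verts H (head H b) r \<noteq> []"
      by (cases r) (simp_all add: pre_digraph.awalk_verts.simps)
    ultimately show ?thesis
      using assms(3) visits by (cases "pre_digraph.awalk_verts H (head H b) r") auto
  qed simp
  then show ?thesis using p loops by simp
qed

text \<open>
  The pigeonhole principle for sequences, with a positive first index because the conditions on
  prefixes and powers in the theorem ask for \<open>n \<ge> 1\<close>.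
\<close>

lemma finite_range_repeats:
  fixes g :: "nat \<Rightarrow> 'b"
  assumes "finite S" "range g \<subseteq> S"
  obtains i j where "1 \<le> i" "i < j" "g i = g j"
proof -
  have "\<not> inj (\<lambda>n. g (Suc n))"
    using assms finite_imageD[of "\<lambda>n. g (Suc n)" UNIV] by (meson finite_subset image_subset_iff
      infinite_UNIV_nat range_subsetD)
  then obtain m n where "m \<noteq> n" "g (Suc m) = g (Suc n)"
    by (auto simp: inj_def)
  then show thesis
    using that[of "Suc m" "Suc n"] that[of "Suc n" "Suc m"] by (cases m n rule: linorder_cases) auto
qed

text \<open>
  A forward orbit stays in the component and, by finiteness, enters a cycle, which the hypothesis
  makes a loop.  The predicate \<open>P\<close> carries further knowledge about periodic points over to the
  vertex of that loop.  Any other cycle starts at a periodic point too, hence at a fixed point, and two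
  fixed points whose forward orbits meet are equal.
\<close>

lemma component_unique_loop:
  assumes "finite V" "f ` V \<subseteq> V"
    and periodic: "\<And>x m. x \<in> V \<Longrightarrow> m \<ge> 1 \<Longrightarrow> (f ^^ m) x = x \<Longrightarrow> f x = x \<and> P x"
    and C: "C \<in> components (with_proj (functional_graph V f))"
  obtains x where "x \<in> V" "P x" "{p. pre_digraph.cycle C p} = {[(x, x)]}"
proof -
  have ind: "induced_subgraph C (with_proj (functional_graph V f))"
    and conn: "Digraph_Component.connected C"
    using C by (auto simp: components_def)
  note C_V = induced_functional_graph_projections(3)[OF ind]
  obtain y where y: "y \<in> verts C"
    using conn by (auto simp: connected_induced_functional_graph_iff[OF ind])
  have orbit: "(f ^^ n) y \<in> verts C" for n
    by (induction n) (auto intro: y component_closed[OF assms(2) C])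
  then have "range (\<lambda>n. (f ^^ n) y) \<subseteq> V"
    using C_V by auto
  then obtain i j where ij: "i < j" "(f ^^ i) y = (f ^^ j) y"
    by (rule finite_range_repeats[OF assms(1)])
  define x where "x = (f ^^ i) y"
  have x: "x \<in> verts C" unfolding x_def by (rule orbit)
  have "(f ^^ (j - i)) x = x"
    using ij funpow_add_apply[of "j - i" i f y] by (simp add: x_def)
  then have fx: "f x = x" "P x"
    using periodic[of x "j - i"] ij(1) x C_V by auto
  have "p = [(x, x)]" if cyc: "pre_digraph.cycle C p" for p
  proof -
    obtain z where z: "pre_digraph.awalk C z p z"
      "distinct (tl (pre_digraph.awalk_verts C z p))" "p \<noteq> []"
      using cyc by (auto simp: pre_digraph.cycle_def)
    have zC: "z \<in> verts C" using z(1) by (simp add: pre_digraph.awalk_def)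
    have fz: "f z = z"
      using periodic[of z "length p"] walk_follows_orbit[OF ind z(1)] z(3) zC C_V
      by (simp add: Suc_leI subset_iff)
    have "\<exists>i j. (f ^^ i) x = (f ^^ j) z"
      using conn x zC
      by (intro linked_orbits_meet[of _ _ "verts C"])
        (simp add: connected_induced_functional_graph_iff[OF ind])
    moreover have "(f ^^ i) x = x" "(f ^^ i) z = z" for i
      by (induction i) (simp_all add: fx fz)
    ultimately have "z = x" by metis
    then show ?thesis
      using cycle_through_fixed_point[OF ind z fz] by simp
  qed
  then have "{p. pre_digraph.cycle C p} = {[(x, x)]}"
    using cycle_at_fixed_point[OF ind fx(1) x] by blast
  then show thesis using that x C_V fx(2) by blast
qed

section \<open>Words acting on words\<close>

lemma finite_words: "finite {w :: 'b::finite list. length w = n}"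
  using finite_lists_length_eq[of "UNIV :: 'b set"] by simp

lemma length_state_act [simp]: "length (state_act M q v) = length v"
  by (induction v arbitrary: q) auto

lemma length_word_act [simp]: "length (word_act M u v) = length v"
  by (induction u) auto

lemma length_word_trans [simp]: "length (word_trans M u v) = length u"
  by (induction u) auto

lemma word_act_Nil_right [simp]: "word_act M u [] = []"
  by (induction u) auto

lemma word_trans_Nil_right [simp]: "word_trans M u [] = u"
  by (induction u) auto

lemma state_act_append:
  "state_act M q (v @ w) = state_act M q v @ state_act M (state_trans M q v) w"
  by (induction v arbitrary: q) auto

lemma state_trans_append: "state_trans M q (v @ w) = state_trans M (state_trans M q v) w"
  by (induction v arbitrary: q) auto

lemma word_act_append_right:
  "word_act M u (v @ w) = word_act M u v @ word_act M (word_trans M u v) w"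
  by (induction u) (auto simp: state_act_append)

lemma word_trans_append_right: "word_trans M u (v @ w) = word_trans M (word_trans M u v) w"
  by (induction u) (auto simp: state_trans_append word_act_append_right)

lemma word_act_append_left: "word_act M (u @ u') v = word_act M u (word_act M u' v)"
  by (induction u) auto

lemma word_trans_append_left:
  "word_trans M (u @ u') v = word_trans M u (word_act M u' v) @ word_trans M u' v"
  by (induction u) (auto simp: word_act_append_left)

lemma sink_state_act: "sink_state M e \<Longrightarrow> state_act M e v = v"
  by (induction v) (auto simp: sink_state_def)

lemma sink_state_trans: "sink_state M e \<Longrightarrow> state_trans M e v = e"
  by (induction v) (auto simp: sink_state_def)

lemma word_act_sinks: "sink_state M e \<Longrightarrow> word_act M (replicate k e) v = v"
  by (induction k) (auto simp: sink_state_act)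

lemma word_trans_sinks: "sink_state M e \<Longrightarrow> word_trans M (replicate k e) v = replicate k e"
  by (induction k) (auto simp: sink_state_trans word_act_sinks)

lemma word_act_strip_sinks:
  "sink_state M e \<Longrightarrow> word_act M (filter (\<lambda>q. q \<noteq> e) u) v = word_act M u v"
  by (induction u) (auto simp: sink_state_act)

lemma word_trans_strip_sinks:
  assumes "sink_state M e" "word_trans M u v = u"
  shows "word_trans M (filter (\<lambda>q. q \<noteq> e) u) v = filter (\<lambda>q. q \<noteq> e) u"
  using assms(2) by (induction u) (auto simp: word_act_strip_sinks[OF assms(1)])

text \<open>Deleting the sinks from \<open>u\<close> would otherwise leave a non-elementary commuting pair.\<close>

lemma commuting_word_is_sinks:
  assumes "sink_state M e" "\<nexists>u v. nonelementary_commuting_pair M e u v"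
    and "word_trans M u v = u" "word_act M u v = v" "v \<noteq> []"
  shows "u = replicate (length u) e"
proof -
  let ?u = "filter (\<lambda>q. q \<noteq> e) u"
  have "word_act M ?u v = v"
    by (simp add: word_act_strip_sinks[OF assms(1)] assms(4))
  moreover have "e \<notin> set ?u"
    by simp
  ultimately have "?u = []"
    using assms(2,5) word_trans_strip_sinks[OF assms(1,3)]
    unfolding nonelementary_commuting_pair_def by metis
  then show ?thesis
    by (intro replicate_eqI) (auto simp: filter_empty_conv)
qed

section \<open>The group action\<close>

lemma bij_state_act:
  assumes "invertible_mealy M"
  shows "bij (state_act M q)"
proof (rule bijI)
  have "v = w" if "state_act M q v = state_act M q w" for v w q
    using that
  proof (induction v arbitrary: q w)
    case Nil
    then show ?case by (cases w) auto
  next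
    case (Cons a v)
    then obtain b w' where w: "w = b # w'" by (cases w) auto
    moreover have "inj (rho M q)"
      using assms by (simp add: invertible_mealy_def bij_is_inj)
    ultimately have "a = b"
      using Cons.prems by (simp add: inj_eq)
    then show ?case using Cons w by auto
  qed
  then show "inj (state_act M q)" by (auto intro: injI)
  have "\<exists>v. state_act M q v = w" for w q
  proof (induction w arbitrary: q)
    case Nil
    show ?case by (rule exI[of _ "[]"]) simp
  next
    case (Cons b w)
    obtain a where "rho M q a = b"
      using assms by (metis invertible_mealy_def bij_pointE)
    moreover obtain v where "state_act M (delta M q a) v = w" using Cons by blast
    ultimately have "state_act M q (a # v) = b # w" by simp
    then show ?case by blast
  qed
  then show "surj (state_act M q)" by (simp add: surj_def) metis
qed

lemma one_word_perms: "\<one>\<^bsub>word_perms\<^esub> = (\<lambda>x. x)"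
  by (simp add: BijGroup_def restrict_def)

lemma word_act_in_Bij:
  assumes "invertible_mealy M"
  shows "word_act M u \<in> Bij UNIV"
proof -
  have "bij (word_act M u)"
  proof (induction u)
    case Nil
    have "word_act M [] = id" by auto
    then show ?case by (simp only: bij_id)
  next
    case (Cons q u)
    have "word_act M (q # u) = state_act M q \<circ> word_act M u" by auto
    then show ?case
      using bij_comp[OF Cons bij_state_act[OF assms]] by (simp only:)
  qed
  then show ?thesis by (simp add: Bij_def)
qed

lemma word_act_in_mealy_group:
  assumes "invertible_mealy M"
  shows "word_act M u \<in> mealy_group M"
proof (induction u)
  case Nil
  have "word_act M [] = \<one>\<^bsub>word_perms\<^esub>" by (auto simp: one_word_perms)
  then show ?case by (simp add: mealy_group_def generate.one del: word_act.simps)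
next
  case (Cons q u)
  have "state_act M q \<in> mealy_group M"
    by (auto simp: mealy_group_def intro: generate.incl)
  moreover have "word_act M (q # u) = state_act M q \<otimes>\<^bsub>word_perms\<^esub> word_act M u"
    using word_act_in_Bij[OF assms, of u] bij_state_act[OF assms, of q]
    by (auto simp: BijGroup_def Bij_def compose_def)
  ultimately show ?case
    using Cons unfolding mealy_group_def by (metis generate.eng)
qed

text \<open>
  Words over the states evaluate to group elements because invertible states permute the tree, and
  a section is unique because a common prefix can be cancelled.
\<close>

lemma group_section_word_act:
  assumes "invertible_mealy M"
  shows "group_section M (word_act M u) v = word_act M (word_trans M u v)"
  unfolding group_section_def
proof (rule the_equality)
  fix h assume "h \<in> mealy_group M \<and> (\<forall>w. word_act M u (v @ w) = word_act M u v @ h w)"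
  then show "h = word_act M (word_trans M u v)"
    by (auto simp: word_act_append_right)
qed (simp add: word_act_in_mealy_group[OF assms] word_act_append_right)

lemma group_section_trivial_iff:
  assumes "invertible_mealy M"
  shows "group_section M (word_act M u) v = \<one>\<^bsub>word_perms\<^esub>
    \<longleftrightarrow> (\<forall>w. word_act M (word_trans M u v) w = w)"
  by (simp add: group_section_word_act[OF assms] one_word_perms fun_eq_iff)

lemma section_of_trivial_word:
  assumes "\<And>w. word_act M u w = w"
  shows "word_act M (word_trans M u v) w = w"
  using assms[of v] assms[of "v @ w"] by (simp add: word_act_append_right)

text \<open>
  Letter \<open>i\<close> of the image of a ray is computed from the prefix of length \<open>i + 1\<close>, but every longer
  prefix gives the same letter, as the action is compatible with prefixes.
\<close>

lemma omega_act_fixes_iff: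
  "omega_act (word_act M u) \<xi> = \<xi> \<longleftrightarrow> (\<forall>n. word_act M u (stake n \<xi>) = stake n \<xi>)"
proof -
  have nth: "word_act M u (stake (Suc i) \<xi>) ! i = word_act M u (stake n \<xi>) ! i" if "i < n" for i n
  proof -
    have "stake n \<xi> = stake (Suc i) \<xi> @ stake (n - Suc i) (sdrop (Suc i) \<xi>)"
      using that by (metis Suc_leI le_add_diff_inverse stake_add)
    then show ?thesis
      by (simp only: word_act_append_right) (simp add: nth_append)
  qed
  have "omega_act (word_act M u) \<xi> = \<xi> \<longleftrightarrow> (\<forall>i. word_act M u (stake (Suc i) \<xi>) ! i = \<xi> !! i)"
    by (simp add: omega_act_def smap_alt del: stake.simps)
  also have "\<dots> \<longleftrightarrow> (\<forall>n. word_act M u (stake n \<xi>) = stake n \<xi>)"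
  proof safe
    fix n assume *: "\<forall>i. word_act M u (stake (Suc i) \<xi>) ! i = \<xi> !! i"
    show "word_act M u (stake n \<xi>) = stake n \<xi>"
      by (rule nth_equalityI) (use * nth in \<open>auto simp del: stake.simps\<close>)
  next
    fix i assume "\<forall>n. word_act M u (stake n \<xi>) = stake n \<xi>"
    then show "word_act M u (stake (Suc i) \<xi>) ! i = \<xi> !! i"
      by (simp add: stake_nth del: stake.simps)
  qed
  finally show ?thesis .
qed

lemma word_pow_prefix_of_cycle:
  assumes "v \<noteq> []"
  shows "word_pow v n = stake (n * length v) (cycle v)"
  using stake_cycle_eq_mod_0[OF assms, of "n * length v"] assms by simp

lemma stake_prefix_of_word_pow:
  assumes "v \<noteq> []"
  obtains w where "word_pow v n = stake n (cycle v) @ w"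
proof -
  have "n \<le> n * length v" using assms by (cases v) auto
  then have "word_pow v n
      = stake n (cycle v) @ stake (n * length v - n) (sdrop n (cycle v))"
    unfolding word_pow_prefix_of_cycle[OF assms] by (metis le_add_diff_inverse stake_add)
  then show thesis by (rule that)
qed

section \<open>Fixed rays\<close>

text \<open>
  If \<open>u\<close> is in the same state after the prefixes of lengths \<open>i < j\<close>, that state commutes with the
  factor of \<open>\<xi>\<close> between the two positions.
\<close>

lemma fixed_ray_reaches_sink:
  fixes M :: "('q::finite, 'a) mealy"
  assumes "sink_state M e" "\<nexists>u v. nonelementary_commuting_pair M e u v"
    and "\<And>n. word_act M u (stake n \<xi>) = stake n \<xi>"
  obtains n where "n \<ge> 1" "word_trans M u (stake n \<xi>) = replicate (length u) e"
proof -
  let ?g = "\<lambda>n. word_trans M u (stake n \<xi>)"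
  note finite_words
  moreover have "range ?g \<subseteq> {w. length w = length u}"
    by auto
  ultimately obtain i j where ij: "1 \<le> i" "i < j" "?g i = ?g j"
    by (rule finite_range_repeats)
  define v where "v = stake (j - i) (sdrop i \<xi>)"
  have j: "stake j \<xi> = stake i \<xi> @ v"
    using ij(2) unfolding v_def by (metis le_add_diff_inverse less_imp_le stake_add)
  have "word_trans M (?g i) v = ?g i"
    using ij(3) by (simp add: j word_trans_append_right)
  moreover have "word_act M (?g i) v = v"
    using assms(3)[of j] assms(3)[of i] by (simp add: j word_act_append_right)
  moreover have "v \<noteq> []"
    using ij(2) unfolding v_def by (metis length_stake list.size(3) zero_less_diff less_numeral_extra(3))
  ultimately have "?g i = replicate (length (?g i)) e"
    by (rule commuting_word_is_sinks[OF assms(1,2)])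
  then show thesis using that[of i] ij(1) by simp
qed

section \<open>Periodic points of the helix map\<close>

text \<open>
  One column of the grid.  The entries \<open>a i, \<dots>, a (i + m - 1)\<close> are read in reverse order, since the
  rightmost letter of a word acts first: \<open>a i\<close> turns \<open>b i\<close> into \<open>b (i + 1)\<close>, which is just the
  word that \<open>a (i + 1)\<close> transforms next.
\<close>

lemma orbit_column_on_letter:
  assumes "\<And>i. a (Suc i) = word_trans M (a i) (b i)" "\<And>i. b (Suc i) = word_act M (a i) (b i)"
  shows "word_act M (concat (map a (rev [i..<i + m]))) (b i) = b (i + m)
    \<and> word_trans M (concat (map a (rev [i..<i + m]))) (b i)
      = concat (map a (rev [Suc i..<Suc i + m]))"
proof (induction m)
  case (Suc m)
  have split: "concat (map a (rev [j..<j + Suc m])) = a (j + m) @ concat (map a (rev [j..<j + m]))" for j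
    by simp
  show ?case
    using Suc assms[of "i + m"]
    unfolding split by (simp only: word_act_append_left word_trans_append_left add_Suc add_Suc_right)
qed simp

text \<open>
  The full grid of \<open>m\<close> rows and \<open>n\<close> columns: passing one column shifts all indices of the
  acting word by one, so the columns can be traversed successively.
\<close>

lemma orbit_column_on_row:
  assumes "\<And>i. a (Suc i) = word_trans M (a i) (b i)" "\<And>i. b (Suc i) = word_act M (a i) (b i)"
  shows "word_act M (concat (map a (rev [i..<i + m]))) (concat (map b [i..<i + n]))
      = concat (map b [i + m..<i + m + n])
    \<and> word_trans M (concat (map a (rev [i..<i + m]))) (concat (map b [i..<i + n]))
      = concat (map a (rev [i + n..<i + n + m]))"
proof (induction n)
  case (Suc n)
  have split: "concat (map b [j..<j + Suc n]) = concat (map b [j..<j + n]) @ b (j + n)" for j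
    by simp
  have "i + n + m = i + m + n"
    by simp
  then show ?case
    using Suc orbit_column_on_letter[of a M b "i + n" m, OF assms]
    unfolding split
    by (simp only: word_act_append_right word_trans_append_right add_Suc add_Suc_right)
qed simp

definition helix_step :: "('q, 'a) mealy \<Rightarrow> 'q list \<times> 'a list \<Rightarrow> 'q list \<times> 'a list" where
  "helix_step M = (\<lambda>(u, v). (word_trans M u v, word_act M u v))"

lemma finite_helix_vertices:
  "finite {(u :: 'q::finite list, v :: 'a::finite list). length u = k \<and> length v = n}"
  by (rule finite_subset[OF _ finite_cartesian_product[OF finite_words[of k] finite_words[of n]]]) auto

lemma helix_step_vertices:
  "helix_step M ` {(u, v). length u = k \<and> length v = n} \<subseteq> {(u, v). length u = k \<and> length v = n}"
  by (auto simp: helix_step_def)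

lemma helix_graph_functional:
  "helix_graph M k n = functional_graph {(u, v). length u = k \<and> length v = n} (helix_step M)"
  by (auto simp: helix_graph_def functional_graph_def helix_step_def)

text \<open>
  If \<open>m\<close> is a period, the opposite sides of the \<open>m\<close> by \<open>m\<close> grid carry the same words, so the
  concatenations \<open>U\<close> and \<open>V\<close> along its sides commute.
\<close>

lemma periodic_helix_vertex:
  assumes "sink_state M e" "\<nexists>u v. nonelementary_commuting_pair M e u v"
    and period: "(helix_step M ^^ m) (u, v) = (u, v)" "m \<ge> 1" and "v \<noteq> []"
  shows "u = replicate (length u) e"
proof -
  define a where "a i = fst ((helix_step M ^^ i) (u, v))" for i
  define b where "b i = snd ((helix_step M ^^ i) (u, v))" for i
  define U where "U = concat (map a (rev [0..<m]))"
  define V where "V = concat (map b [0..<m])"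
  have steps: "a (Suc i) = word_trans M (a i) (b i)" "b (Suc i) = word_act M (a i) (b i)" for i
    by (simp_all add: a_def b_def helix_step_def split_beta)
  have "(helix_step M ^^ (i + m)) (u, v) = (helix_step M ^^ i) (u, v)" for i
    using period(1) by (simp only: funpow_add_apply)
  then have shift: "map a [m..<m + m] = map a [0..<m]" "map b [m..<m + m] = map b [0..<m]"
    by (simp_all add: a_def b_def map_add_upt[symmetric])
  then have "word_trans M U V = U" "word_act M U V = V"
    using orbit_column_on_row[of a M b 0 m m, OF steps]
    by (simp_all add: U_def V_def rev_map[symmetric])
  moreover have ends: "u \<in> set (map a (rev [0..<m]))" "v \<in> set (map b [0..<m])"
    using period(2) by (force simp: a_def b_def intro!: rev_image_eqI[of 0])+
  then have "V \<noteq> []"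
    using assms(5) by (auto simp: V_def)
  ultimately have "U = replicate (length U) e"
    by (rule commuting_word_is_sinks[OF assms(1,2)])
  then have "set U \<subseteq> {e}"
    by (metis set_replicate_conv_if empty_subsetI order_refl)
  then have "set u \<subseteq> {e}"
    using ends(1) by (auto simp: U_def)
  then show ?thesis
    by (intro replicate_eqI) auto
qed

lemma singular_helix_iff_no_commuting_pair:
  fixes M :: "('q::finite, 'a::finite) mealy"
  assumes "sink_state M e"
  shows "(\<forall>k\<ge>1. \<forall>n\<ge>1. singular_helix M e k n) \<longleftrightarrow> (\<nexists>u v. nonelementary_commuting_pair M e u v)"
proof (intro iffI allI impI)
  assume singular: "\<forall>k\<ge>1. \<forall>n\<ge>1. singular_helix M e k n"
  show "\<nexists>u v. nonelementary_commuting_pair M e u v"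
  proof
    assume "\<exists>u v. nonelementary_commuting_pair M e u v"
    then obtain u v where uv: "u \<noteq> []" "v \<noteq> []" "e \<notin> set u" "word_trans M u v = u" "word_act M u v = v"
      by (auto simp: nonelementary_commuting_pair_def)
    let ?V = "{(u', v'). length u' = length u \<and> length v' = length v} :: ('q list \<times> 'a list) set"
    obtain C where C: "C \<in> components (with_proj (functional_graph ?V (helix_step M)))"
        "(u, v) \<in> verts C"
      using finite_helix_vertices helix_step_vertices
      by (rule vertex_in_component[where x = "(u, v)"]) auto
    have "pre_digraph.cycle C [((u, v), (u, v))]"
      using C uv by (intro cycle_at_fixed_point[of C ?V "helix_step M"])
        (auto simp: components_def helix_step_def)
    moreover have "singular_helix M e (length u) (length v)"
      using singular uv by (simp add: Suc_leI)
    moreover obtain w where "{p. pre_digraph.cycle C p}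
        = {[((replicate (length u) e, w), (replicate (length u) e, w))]}"
      using bspec[OF calculation(2)[unfolded singular_helix_def helix_graph_functional] C(1)] by auto
    ultimately have "u = replicate (length u) e"
      by (metis list.inject mem_Collect_eq prod.inject singletonD)
    then show False
      using uv(1,3) by (metis in_set_replicate length_0_conv list.set_sel(1))
  qed
next
  fix k n :: nat
  assume no_pair: "\<nexists>u v. nonelementary_commuting_pair M e u v" and "1 \<le> k" and n: "1 \<le> n"
  let ?V = "{(u, v). length u = k \<and> length v = n} :: ('q list \<times> 'a list) set"
  have periodic: "helix_step M x = x \<and> fst x = replicate k e"
    if xV: "x \<in> ?V" and m: "m \<ge> 1" "(helix_step M ^^ m) x = x" for x m
  proof -
    obtain u v where x: "x = (u, v)" "length u = k" "length v = n"
      using xV by auto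
    then have "u = replicate k e"
      using periodic_helix_vertex[OF assms no_pair, of m u v] m x n by (cases v) auto
    then show ?thesis
      by (simp add: x(1) helix_step_def word_act_sinks[OF assms] word_trans_sinks[OF assms])
  qed
  show "singular_helix M e k n"
    unfolding singular_helix_def helix_graph_functional
  proof
    fix C assume C: "C \<in> components (with_proj (functional_graph ?V (helix_step M)))"
    show "\<exists>v. length v = n
        \<and> {p. pre_digraph.cycle C p} = {[((replicate k e, v), (replicate k e, v))]}"
    proof (rule component_unique_loop[where P = "\<lambda>x. fst x = replicate k e", OF finite_helix_vertices
          helix_step_vertices _ C])
      show "helix_step M x = x \<and> fst x = replicate k e"
        if "x \<in> ?V" "m \<ge> 1" "(helix_step M ^^ m) x = x" for x m
        using that by (rule periodic)
    next
      fix x assume x: "x \<in> ?V" "fst x = replicate k e" "{p. pre_digraph.cycle C p} = {[(x, x)]}"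
      obtain v where v: "x = (replicate k e, v)" "length v = n"
        using x(1,2) by (cases x) auto
      show ?thesis
        using v(2) x(3)[unfolded v(1)] by blast
    qed
  qed
qed

lemma commuting_pair_trans_pow:
  assumes "word_trans M u v = u" "word_act M u v = v"
  shows "word_trans M u (word_pow v n) = u" "word_act M u (word_pow v n) = word_pow v n"
  by (induction n) (auto simp: assms word_trans_append_right word_act_append_right)

theorem proposition6p11:
  fixes M :: "('q::finite, 'a::finite) mealy" and e :: 'q
  assumes "M \<in> class_Sa" and "sink_state M e"
  shows
    "((nonelementary_relations M e = {} \<and>
        (\<forall>\<xi>. \<forall>g \<in> Stab_plus M \<xi>. \<exists>n\<ge>1. group_section M g (stake n \<xi>) = \<one>\<^bsub>word_perms\<^esub>))
      \<longleftrightarrow>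
      (nonelementary_relations M e = {} \<and>
        (\<forall>v. v \<noteq> [] \<longrightarrow> (\<forall>g \<in> Stab_plus M (cycle v).
           \<exists>n\<ge>1. group_section M g (word_pow v n) = \<one>\<^bsub>word_perms\<^esub>))))
     \<and>
     ((nonelementary_relations M e = {} \<and>
        (\<forall>v. v \<noteq> [] \<longrightarrow> (\<forall>g \<in> Stab_plus M (cycle v).
           \<exists>n\<ge>1. group_section M g (word_pow v n) = \<one>\<^bsub>word_perms\<^esub>)))
      \<longleftrightarrow>
      (\<forall>k\<ge>1. \<forall>n\<ge>1. singular_helix M e k n))
     \<and>
     ((\<forall>k\<ge>1. \<forall>n\<ge>1. singular_helix M e k n)
      \<longleftrightarrow>
      \<not> (\<exists>u v. nonelementary_commuting_pair M e u v))"
    (is "((?E \<and> ?rays) \<longleftrightarrow> (?E \<and> ?periodic)) \<and> (_ \<longleftrightarrow> _) \<and> (_ \<longleftrightarrow> ?no_pair)")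
proof -
  have inv: "invertible_mealy M"
    using assms(1) by (simp add: class_Sa_def)
  note trivial_iff = group_section_trivial_iff[OF inv]
  \<comment> \<open>From (i) to (ii): once the section at a prefix is trivial, so are all later sections.\<close>
  have rays_periodic: ?periodic if rays: ?rays
  proof (intro allI impI ballI)
    fix v :: "'a list" and g assume v: "v \<noteq> []" and g: "g \<in> Stab_plus M (cycle v)"
    then obtain u where u: "g = word_act M u" by (auto simp: Stab_plus_def)
    obtain n where n: "n \<ge> 1" "\<And>w. word_act M (word_trans M u (stake n (cycle v))) w = w"
      using rays[rule_format, OF g] unfolding u trivial_iff by blast
    obtain w where w: "word_pow v n = stake n (cycle v) @ w"
      by (rule stake_prefix_of_word_pow[OF v])
    have "word_act M (word_trans M u (word_pow v n)) x = x" for x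
      unfolding w word_trans_append_right by (rule section_of_trivial_word) (rule n(2))
    then show "\<exists>n\<ge>1. group_section M g (word_pow v n) = \<one>\<^bsub>word_perms\<^esub>"
      using n(1) unfolding u trivial_iff by blast
  qed
  have periodic_no_pair: ?no_pair if E: ?E and P: ?periodic
  proof
    assume "\<exists>u v. nonelementary_commuting_pair M e u v"
    then obtain u v where uv: "u \<noteq> []" "v \<noteq> []" "e \<notin> set u" "word_trans M u v = u" "word_act M u v = v"
      by (auto simp: nonelementary_commuting_pair_def)
    note pow = commuting_pair_trans_pow[OF uv(4,5)]
    have "word_act M u (stake n (cycle v)) = stake n (cycle v)" for n
    proof -
      obtain w where "word_pow v n = stake n (cycle v) @ w"
        by (rule stake_prefix_of_word_pow[OF uv(2)])
      then show ?thesis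
        using pow(2)[of n] by (simp add: word_act_append_right)
    qed
    then have "word_act M u \<in> Stab_plus M (cycle v)"
      unfolding Stab_plus_def using omega_act_fixes_iff[of M u "cycle v"] by blast
    from P[rule_format, OF uv(2) this] have "\<forall>x. word_act M u x = x"
      by (auto simp: trivial_iff pow(1))
    then have "word_act M u = \<one>\<^bsub>word_perms\<^esub>"
      by (simp add: one_word_perms fun_eq_iff)
    moreover have "count_list (word_trans M u (word_pow v n)) e < length u" for n
      using uv(1,3) by (simp add: pow(1) count_notin)
    ultimately have "u \<in> nonelementary_relations M e"
      using uv(2,3) unfolding nonelementary_relations_def by blast
    then show False using E by simp
  qed
  have no_pair_E: ?E if no_pair: ?no_pair
  proof (rule ccontr)
    assume "\<not> ?E"
    then obtain u v where u: "word_act M u = (\<lambda>x. x)" and v: "v \<noteq> []"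
      and few: "\<forall>n\<ge>1. count_list (word_trans M u (word_pow v n)) e < length u"
      unfolding nonelementary_relations_def one_word_perms by blast
    obtain n where n: "n \<ge> 1" "word_trans M u (stake n (cycle v)) = replicate (length u) e"
      by (rule fixed_ray_reaches_sink[OF assms(2) no_pair, of u "cycle v"]) (simp add: u)
    obtain w where "word_pow v n = stake n (cycle v) @ w"
      by (rule stake_prefix_of_word_pow[OF v])
    then have "word_trans M u (word_pow v n) = replicate (length u) e"
      by (simp add: word_trans_append_right n(2) word_trans_sinks[OF assms(2)])
    moreover have "count_list (replicate k e) e = k" for k
      by (induction k) auto
    ultimately show False
      using few n(1) by fastforce
  qed
  have no_pair_rays: ?rays if no_pair: ?no_pair
  proof (intro allI ballI)
    fix \<xi> g assume "g \<in> Stab_plus M \<xi>"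
    then obtain u where u: "g = word_act M u" "\<And>n. word_act M u (stake n \<xi>) = stake n \<xi>"
      unfolding Stab_plus_def by (auto simp: omega_act_fixes_iff)
    obtain n where n: "n \<ge> 1" "word_trans M u (stake n \<xi>) = replicate (length u) e"
      by (rule fixed_ray_reaches_sink[OF assms(2) no_pair u(2)])
    have "group_section M g (stake n \<xi>) = \<one>\<^bsub>word_perms\<^esub>"
      by (simp add: u(1) trivial_iff n(2) word_act_sinks[OF assms(2)])
    then show "\<exists>n\<ge>1. group_section M g (stake n \<xi>) = \<one>\<^bsub>word_perms\<^esub>"
      using n(1) by blast
  qed
  show ?thesis
    using rays_periodic periodic_no_pair no_pair_E no_pair_rays
      singular_helix_iff_no_commuting_pair[OF assms(2)] by argo
qed

end
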